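(* Let $\sigma,n\ge2$ be integers with $\sigma\le n$. Any data structure supporting suffix array queries for every text $T\in[0..\sigma)^n$ has worst-case space usage $\Omega(n\log\sigma)$ bits; that is, there is an absolute constant $\delta>0$ such that for all integers $2\le\sigma\le n$, any such data structure uses at least $\delta\,n\log\sigma$ bits on some $T\in[0..\sigma)^n$.
   Context: Here $[0..\sigma)=\{0,\dots,\sigma-1\}$ and $\log$ is base 2. For a text $T$ of length $n$, the suffix array $\mathrm{SA}_T[1..n]$ is the permutation of $\{1,\dots,n\}$ such that $T[\mathrm{SA}_T[1]..n]\prec\cdots\prec T[\mathrm{SA}_T[n]..n]$ lexicographically (a proper prefix of a string precedes that string). A suffix array query takes $i\in\{1,\dots,n\}$ and returns $\mathrm{SA}_T[i]$. A data structure supporting a query problem for a family of inputs (with parameters $\sigma,n$ fixed) assigns to each input a finite bit string; the answer to every query on an input is determined by the stored bit string and the query arguments only. The space used on an input is the length of its bit string, and the worst-case space usage is the maximum over all inputs in the family. Query time is irrelevant. *)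

theory Defs
  imports Complex_Main "HOL-Combinatorics.Permutations"
begin

definition texts :: "nat \<Rightarrow> nat \<Rightarrow> nat list set" where
  "texts \<sigma> n = {T. set T \<subseteq> {0..<\<sigma>} \<and> length T = n}"

text \<open>Positions in a text are counted from 1, so the suffix \<open>T[j..n]\<close> drops \<open>j - 1\<close> letters.\<close>

definition text_suffix :: "nat list \<Rightarrow> nat \<Rightarrow> nat list" where
  "text_suffix T j = drop (j - 1) T"

text \<open>In \<^const>\<open>lexord\<close> a proper prefix of a list precedes that list.\<close>

definition lex_less :: "nat list \<Rightarrow> nat list \<Rightarrow> bool" where
  "lex_less u v \<longleftrightarrow> (u, v) \<in> lexord less_than"

definition is_suffix_array :: "nat list \<Rightarrow> (nat \<Rightarrow> nat) \<Rightarrow> bool" where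
  "is_suffix_array T p \<longleftrightarrow> p permutes {1..length T} \<and>
     (\<forall>i\<in>{1..length T}. \<forall>j\<in>{1..length T}.
        i < j \<longrightarrow> lex_less (text_suffix T (p i)) (text_suffix T (p j)))"

definition suffix_array :: "nat list \<Rightarrow> nat \<Rightarrow> nat" where
  "suffix_array T = (THE p. is_suffix_array T p)"

text \<open>
  A data structure consists of an encoding of the inputs as bit strings and a query procedure that
  sees only the stored bit string and the query arguments. Both are arbitrary functions.
\<close>

definition supports_queries ::
    "'x set \<Rightarrow> 'q set \<Rightarrow> ('x \<Rightarrow> 'q \<Rightarrow> 'a) \<Rightarrow> ('x \<Rightarrow> bool list) \<Rightarrow> (bool list \<Rightarrow> 'q \<Rightarrow> 'a) \<Rightarrow> bool" where
  "supports_queries X Q ans enc query \<longleftrightarrow> (\<forall>x\<in>X. \<forall>q\<in>Q. query (enc x) q = ans x q)"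

definition worst_case_space :: "'x set \<Rightarrow> ('x \<Rightarrow> bool list) \<Rightarrow> nat" where
  "worst_case_space X enc = Max ((\<lambda>x. length (enc x)) ` X)"

lemma finite_texts: "finite (texts \<sigma> n)"
  unfolding texts_def by (rule finite_lists_length_eq) simp

lemma texts_nonempty:
  assumes "\<sigma> \<ge> 1"
  shows "texts \<sigma> n \<noteq> {}"
proof -
  have "replicate n 0 \<in> texts \<sigma> n"
    using assms by (auto simp: texts_def)
  then show ?thesis by blast
qed

lemma worst_case_space_texts_ge_iff:
  assumes "\<sigma> \<ge> 1"
  shows "c \<le> real (worst_case_space (texts \<sigma> n) enc) \<longleftrightarrow> (\<exists>T\<in>texts \<sigma> n. c \<le> real (length (enc T)))"
proof -
  let ?S = "(\<lambda>T. length (enc T)) ` texts \<sigma> n"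
  have fin: "finite ?S" and ne: "?S \<noteq> {}"
    using finite_texts texts_nonempty[OF assms] by auto
  have "Max ?S \<in> ?S" using fin ne by (rule Max_in)
  then obtain T where T: "T \<in> texts \<sigma> n" "Max ?S = length (enc T)" by blast
  have le: "length (enc U) \<le> Max ?S" if "U \<in> texts \<sigma> n" for U
    using fin that by auto
  show ?thesis
    unfolding worst_case_space_def
  proof
    assume "c \<le> real (Max ?S)"
    with T show "\<exists>T\<in>texts \<sigma> n. c \<le> real (length (enc T))" by auto
  next
    assume "\<exists>T\<in>texts \<sigma> n. c \<le> real (length (enc T))"
    then obtain U where U: "U \<in> texts \<sigma> n" "c \<le> real (length (enc U))" by blast
    from le[OF U(1)] have "real (length (enc U)) \<le> real (Max ?S)" by (rule of_nat_mono)
    with U(2) show "c \<le> real (Max ?S)" by (rule order_trans)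
  qed
qed

lemma lex_less_irrefl: "\<not> lex_less u u"
  unfolding lex_less_def by (rule lexord_irreflexive) simp

lemma lex_less_trans: "lex_less u v \<Longrightarrow> lex_less v w \<Longrightarrow> lex_less u w"
  unfolding lex_less_def by (erule (1) lexord_trans) (rule trans_less_than)

lemma lex_less_linear: "lex_less u v \<or> u = v \<or> lex_less v u"
  unfolding lex_less_def by (rule lexord_linear) auto

lemma ex1_suffix_array: "\<exists>!p. is_suffix_array T p"
proof -
  let ?A = "{1..length T}"
  let ?less = "\<lambda>i j. lex_less (text_suffix T i) (text_suffix T j)"
  define f where "f j = (if j \<in> ?A then Suc (card {i\<in>?A. ?less i j}) else j)" for j
  have inj_suffix: "i = j" if "i \<in> ?A" "j \<in> ?A" "text_suffix T i = text_suffix T j" for i j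
  proof -
    have "length (text_suffix T i) = length (text_suffix T j)" using that by simp
    then have "length T - (i - 1) = length T - (j - 1)" by (simp add: text_suffix_def)
    moreover have "1 \<le> i" "i \<le> length T" "1 \<le> j" "j \<le> length T" using that by auto
    ultimately show ?thesis by linarith
  qed
  have f_mono: "f i < f j" if "i \<in> ?A" "j \<in> ?A" "?less i j" for i j
  proof -
    have "{k\<in>?A. ?less k i} \<subset> {k\<in>?A. ?less k j}"
      using that lex_less_trans lex_less_irrefl by blast
    then have "card {k\<in>?A. ?less k i} < card {k\<in>?A. ?less k j}"
      by (intro psubset_card_mono) auto
    with that show ?thesis by (simp add: f_def)
  qed
  have f_less: "?less i j" if "i \<in> ?A" "j \<in> ?A" "f i < f j" for i j
    using lex_less_linear[of "text_suffix T i" "text_suffix T j"] inj_suffix[OF that(1,2)]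
      f_mono[OF that(2,1)] that(3) by force
  have f_inj: "inj_on f ?A"
  proof (rule inj_onI)
    fix i j assume ij: "i \<in> ?A" "j \<in> ?A" "f i = f j"
    then show "i = j"
      using lex_less_linear[of "text_suffix T i" "text_suffix T j"]
        f_mono[OF ij(1,2)] f_mono[OF ij(2,1)] inj_suffix[OF ij(1,2)] by auto
  qed
  have f_into: "f j \<in> ?A" if "j \<in> ?A" for j
  proof -
    have "{i\<in>?A. ?less i j} \<subset> ?A"
      using that lex_less_irrefl by blast
    then have "card {i\<in>?A. ?less i j} < card ?A"
      by (intro psubset_card_mono) auto
    with that show ?thesis by (simp add: f_def)
  qed
  have "f ` ?A = ?A"
    using f_into f_inj by (intro endo_inj_surj) auto
  then have "bij_betw f ?A ?A" using f_inj by (simp add: bij_betw_def)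
  then have f_perm: "f permutes ?A"
    by (rule bij_imp_permutes) (auto simp: f_def)
  let ?p = "inv f"
  have p_perm: "?p permutes ?A" using f_perm by (rule permutes_inv)
  have "is_suffix_array T ?p"
    unfolding is_suffix_array_def
  proof (intro conjI ballI impI p_perm)
    fix i j assume ij: "i \<in> ?A" "j \<in> ?A" "i < j"
    have "?p i \<in> ?A" "?p j \<in> ?A"
      using ij permutes_in_image[OF p_perm] by blast+
    moreover have "f (?p i) = i" "f (?p j) = j"
      using permutes_inverses(1)[OF f_perm] by auto
    ultimately show "?less (?p i) (?p j)" using f_less ij(3) by metis
  qed
  moreover have "q = ?p" if q: "is_suffix_array T q" for q
  proof -
    have q_perm: "q permutes ?A"
      and q_mono: "\<And>i j. i \<in> ?A \<Longrightarrow> j \<in> ?A \<Longrightarrow> i < j \<Longrightarrow> ?less (q i) (q j)"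
      using q by (auto simp: is_suffix_array_def)
    have fq: "f (q i) = i" for i
    proof (cases "i \<in> ?A")
      case True
      then have qi: "q i \<in> ?A" using permutes_in_image[OF q_perm] by blast
      have "{k\<in>?A. ?less k (q i)} = q ` {1..<i}"
      proof (intro equalityI subsetI)
        fix k assume k: "k \<in> {k\<in>?A. ?less k (q i)}"
        then obtain m where m: "m \<in> ?A" "k = q m"
          using permutes_image[OF q_perm] by blast
        have "m < i"
        proof (rule ccontr)
          assume "\<not> m < i"
          then have "m = i \<or> ?less (q i) (q m)" using q_mono[OF True m(1)] by force
          with k m(2) show False using lex_less_irrefl lex_less_trans by blast
        qed
        with m show "k \<in> q ` {1..<i}" by auto
      next
        fix k assume "k \<in> q ` {1..<i}"
        then obtain m where m: "m \<in> {1..<i}" "k = q m" by blast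
        then have mA: "m \<in> ?A" using True by auto
        then have "q m \<in> ?A" using permutes_in_image[OF q_perm] by blast
        with q_mono[OF mA True] m show "k \<in> {k\<in>?A. ?less k (q i)}" by auto
      qed
      then have "card {k\<in>?A. ?less k (q i)} = i - 1"
        using permutes_inj[OF q_perm] by (simp add: card_image inj_on_subset)
      with qi True show ?thesis by (simp add: f_def)
    next
      case False
      with q_perm f_perm show ?thesis by (simp add: permutes_not_in)
    qed
    show ?thesis
    proof
      fix i
      have "?p (f (q i)) = q i" using permutes_inverses(2)[OF f_perm] by auto
      then show "q i = ?p i" by (simp add: fq)
    qed
  qed
  ultimately show ?thesis by blast
qed

lemma is_suffix_array_suffix_array: "is_suffix_array T (suffix_array T)"
  unfolding suffix_array_def using ex1_suffix_array by (rule theI')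

end

theory Submission
  imports Defs "HOL-Combinatorics.Multiset_Permutations"
begin

text \<open>
  The letters of a text, read in suffix array order, are sorted; so the suffix array together with
  the multiset of letters determines the text. Concatenating \<open>n div \<sigma>\<close> permutations of the alphabet
  and padding with zeros gives \<open>(\<sigma>!) ^ (n div \<sigma>)\<close> texts with one and the same multiset of letters,
  hence with different suffix arrays and different encodings, and \<open>(\<sigma>!)\<^sup>2 \<ge> \<sigma>\<^sup>\<sigma>\<close> makes the logarithm
  of this number at least \<open>(n log \<sigma>) / 4\<close>.
\<close>

lemma lex_less_imp_hd_le:
  assumes "lex_less u v" and "u \<noteq> []"
  shows "hd u \<le> hd v"
  using assms by (cases u; cases v) (auto simp: lex_less_def)

text \<open>Suffixes in increasing order have weakly increasing first letters, and a permutation of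
  the positions keeps the multiset of letters. A sorted list with the multiset of \<open>T\<close>
  can only be \<open>sort T\<close>.\<close>

lemma map_nth_suffix_array_eq_sort:
  "map (\<lambda>i. T ! (suffix_array T i - 1)) [1..<Suc (length T)] = sort T"
proof -
  let ?n = "length T" and ?p = "suffix_array T"
  let ?L = "map (\<lambda>i. T ! (?p i - 1)) [1..<Suc ?n]"
  have perm: "?p permutes {1..?n}"
    and mono: "\<And>i j. i \<in> {1..?n} \<Longrightarrow> j \<in> {1..?n} \<Longrightarrow> i < j \<Longrightarrow>
      lex_less (text_suffix T (?p i)) (text_suffix T (?p j))"
    using is_suffix_array_suffix_array[of T] by (auto simp: is_suffix_array_def)
  have range: "?p i \<in> {1..?n}" if "i \<in> {1..?n}" for i
    using permutes_in_image[OF perm] that by blast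
  \<comment> \<open>Text positions start at 1 and list indices at 0, hence \<open>j - 1\<close>.
    Nonemptiness gives \<open>hd\<close> a meaning here and is a premise of
    \<open>lex_less_imp_hd_le\<close>.\<close>
  have hd_suffix: "text_suffix T j \<noteq> [] \<and> hd (text_suffix T j) = T ! (j - 1)" if "j \<in> {1..?n}" for j
    using that by (auto simp: text_suffix_def hd_drop_conv_nth)
  have "sorted ?L"
    unfolding sorted_wrt_iff_nth_less
  proof (intro allI impI)
    fix i j assume ij: "i < j" "j < length ?L"
    then have S: "Suc i \<in> {1..?n}" "Suc j \<in> {1..?n}" "Suc i < Suc j" by (auto simp del: upt_Suc)
    have "T ! (?p (Suc i) - 1) \<le> T ! (?p (Suc j) - 1)"
      using lex_less_imp_hd_le[OF mono[OF S]] hd_suffix[OF range[OF S(1)]] hd_suffix[OF range[OF S(2)]]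
      by simp
    then show "?L ! i \<le> ?L ! j"
      using ij by (simp del: upt_Suc)
  qed
  moreover have "mset ?L = mset T"
  proof -
    have "mset ?L = image_mset (\<lambda>j. T ! (j - 1)) (image_mset ?p (mset_set {1..?n}))"
      by (simp add: atLeastLessThanSuc_atLeastAtMost multiset.map_comp comp_def del: upt_Suc)
    \<comment> \<open>The permutation only reorders the positions; what remains is the shift from
      positions to list indices.\<close>
    also have "image_mset ?p (mset_set {1..?n}) = mset_set {1..?n}"
      using image_mset_mset_set[OF permutes_inj_on[OF perm]] permutes_image[OF perm] by simp
    also have "{1..?n} = Suc ` {0..<?n}"
      by (simp add: image_Suc_atLeastLessThan atLeastLessThanSuc_atLeastAtMost)
    also have "mset_set (Suc ` {0..<?n}) = image_mset Suc (mset_set {0..<?n})"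
      by (rule image_mset_mset_set[symmetric]) simp
    also have "image_mset (\<lambda>j. T ! (j - 1)) (image_mset Suc (mset_set {0..<?n})) = mset (map ((!) T) [0..<?n])"
      by (simp add: multiset.map_comp comp_def)
    also have "\<dots> = mset T" by (simp only: map_nth)
    finally show ?thesis .
  qed
  ultimately show ?thesis by (metis properties_for_sort)
qed

text \<open>The common multiset fixes one sorted list, and the common suffix array tells at which
  position of the text each entry of that list stands.\<close>

lemma eq_if_mset_eq_and_suffix_array_eq:
  assumes mset: "mset T = mset U"
    and sa: "\<And>i. i \<in> {1..length T} \<Longrightarrow> suffix_array T i = suffix_array U i"
  shows "T = U"
proof (rule nth_equalityI)
  show len: "length T = length U" using mset by (rule mset_eq_length)
  fix j assume j: "j < length T"
  have perm: "suffix_array T permutes {1..length T}"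
    using is_suffix_array_suffix_array[of T] by (simp add: is_suffix_array_def)
  \<comment> \<open>Surjectivity of the suffix array: the letter at index \<open>j\<close> does
    occur in the sorted list, at some rank \<open>i\<close>.\<close>
  have "Suc j \<in> suffix_array T ` {1..length T}"
    unfolding permutes_image[OF perm] using j by simp
  then obtain i where i: "i \<in> {1..length T}" "suffix_array T i = Suc j" by force
  have "sort T = sort U" using mset by (metis properties_for_sort mset_sort sorted_sort)
  then have eq: "map (\<lambda>i. T ! (suffix_array T i - 1)) [1..<Suc (length T)] =
      map (\<lambda>i. U ! (suffix_array U i - 1)) [1..<Suc (length T)]"
    by (metis map_nth_suffix_array_eq_sort len)
  have "T ! (suffix_array T i - 1) = U ! (suffix_array U i - 1)"
    using eq i(1) by (simp add: map_eq_conv del: upt_Suc)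
  then show "T ! j = U ! j" by (simp only: sa[OF i(1), symmetric] i(2) diff_Suc_1)
qed

text \<open>Multiply the factorial by itself in reversed order: factor \<open>i\<close> meets
  \<open>n + 1 - i\<close>, and each of these \<open>n\<close> products is at least
  \<open>n\<close>.\<close>

lemma power_self_le_fact_squared: "n ^ n \<le> (fact n :: nat)\<^sup>2"
proof -
  have rev: "(fact n :: nat) = (\<Prod>i=1..n. n + 1 - i)"
    unfolding fact_prod of_nat_id
    by (rule prod.reindex_bij_witness[of _ "\<lambda>i. n + 1 - i" "\<lambda>i. n + 1 - i"]) auto
  have le: "n \<le> i * (n + 1 - i)" if i: "i \<in> {1..n}" for i
  proof -
    \<comment> \<open>In these terms the product is \<open>Suc a * Suc b\<close>, which equals
      \<open>n + a * b\<close>.\<close>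
    obtain a b where "i = Suc a" "n = Suc (a + b)"
      using i by (metis Suc_le_D add_Suc atLeastAtMost_iff le_Suc_ex One_nat_def)
    then show ?thesis by simp
  qed
  have "n ^ n = (\<Prod>i=1..n. n)" by simp
  also have "\<dots> \<le> (\<Prod>i=1..n. i * (n + 1 - i))"
    using le by (intro prod_mono) auto
  also have "\<dots> = (fact n)\<^sup>2"
    unfolding prod.distrib rev[symmetric] by (simp add: fact_prod power2_eq_square)
  finally show ?thesis .
qed

text \<open>Every block has length \<open>\<sigma>\<close> and contains each letter once. The
  uniform length lets a text be cut back into its blocks, so distinct block sequences give distinct
  texts. Positivity of \<open>\<sigma>\<close> makes the padding 0 a letter.\<close>

lemma texts_with_common_mset:
  assumes "0 < \<sigma>"
  obtains F M where "F \<subseteq> texts \<sigma> n" "\<And>T. T \<in> F \<Longrightarrow> mset T = M"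
    "card F = fact \<sigma> ^ (n div \<sigma>)"
proof -
  let ?k = "n div \<sigma>" and ?P = "permutations_of_set {0..<\<sigma>}"
  let ?B = "{Bs. set Bs \<subseteq> ?P \<and> length Bs = ?k}"
  let ?f = "\<lambda>Bs. concat Bs @ replicate (n mod \<sigma>) (0::nat)"
  have P: "set B = {0..<\<sigma>} \<and> length B = \<sigma> \<and> mset B = mset_set {0..<\<sigma>}" if "B \<in> ?P" for B
    using that unfolding permutations_of_set_def
    by (metis (mono_tags, lifting) card_atLeastLessThan diff_zero distinct_card mem_Collect_eq mset_set_set)
  have len: "length (concat Bs) = \<sigma> * length Bs" if "set Bs \<subseteq> ?P" for Bs
    using that by (induction Bs) (simp_all add: P)
  have mset: "mset (concat Bs) = repeat_mset (length Bs) (mset_set {0..<\<sigma>})" if "set Bs \<subseteq> ?P" for Bs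
    using that by (induction Bs) (simp_all add: P)
  have inj: "inj_on ?f ?B"
  proof (rule inj_onI)
    fix As Bs assume A: "As \<in> ?B" and B: "Bs \<in> ?B" and eq: "?f As = ?f Bs"
    have "\<forall>(x, y)\<in>set (zip As Bs). length x = length y"
    proof (intro ballI, clarify)
      fix x y assume "(x, y) \<in> set (zip As Bs)"
      then have "x \<in> ?P" "y \<in> ?P" using A B by (blast dest: set_zip_leftD set_zip_rightD)+
      then show "length x = length y" using P by metis
    qed
    with A B eq show "As = Bs" by (intro concat_injective) auto
  qed
  show ?thesis
  proof (rule that[of "?f ` ?B"])
    show "?f ` ?B \<subseteq> texts \<sigma> n"
    proof
      fix T assume "T \<in> ?f ` ?B"
      then obtain Bs where Bs: "T = ?f Bs" "set Bs \<subseteq> ?P" "length Bs = ?k" by blast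
      have "length T = n" using Bs len[OF Bs(2)] by simp
      moreover have "set T \<subseteq> {0..<\<sigma>}"
      proof -
        have "set B \<subseteq> {0..<\<sigma>}" if "B \<in> set Bs" for B
          using Bs(2) P that by blast
        then show ?thesis using assms by (auto simp: Bs(1))
      qed
      ultimately show "T \<in> texts \<sigma> n" by (simp add: texts_def)
    qed
    show "mset T = repeat_mset ?k (mset_set {0..<\<sigma>}) + replicate_mset (n mod \<sigma>) 0"
      if "T \<in> ?f ` ?B" for T
      using that mset by auto
    have "card (?f ` ?B) = card ?P ^ ?k"
      by (simp only: card_image[OF inj] card_lists_length_eq finite_permutations_of_set)
    then show "card (?f ` ?B) = fact \<sigma> ^ ?k" by simp
  qed
qed

text \<open>Encodings may differ in length, so all bit strings of length up to \<open>L\<close> are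
  counted; there are \<open>2 ^ Suc L - 1\<close> of them.\<close>

lemma card_lt_two_power_if_inj_on_bool_lists:
  fixes enc :: "'x \<Rightarrow> bool list"
  assumes "inj_on enc F" and "\<And>x. x \<in> F \<Longrightarrow> length (enc x) \<le> L"
  shows "card F < 2 ^ Suc L"
proof -
  let ?S = "{bs :: bool list. set bs \<subseteq> UNIV \<and> length bs \<le> L}"
  have "card F \<le> card ?S"
    using assms finite_lists_length_le[of "UNIV :: bool set" L] by (intro card_inj_on_le[of enc]) auto
  also have "\<dots> = (\<Sum>i\<le>L. 2 ^ i)"
    by (subst card_lists_length_le) auto
  also have "\<dots> < 2 ^ Suc L"
    by (induction L) auto
  finally show ?thesis .
qed

text \<open>The constant 8 is a product of three losses of a factor 2: rounding \<open>n\<close>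
  down to a multiple of \<open>\<sigma>\<close>, replacing the factorial by its square, and bounding
  \<open>Suc L\<close> by \<open>2 * L\<close> for the space \<open>L\<close>.\<close>

lemma worst_case_space_suffix_array_ge:
  fixes enc :: "nat list \<Rightarrow> bool list" and query :: "bool list \<Rightarrow> nat \<Rightarrow> nat"
  assumes "2 \<le> \<sigma>" "\<sigma> \<le> n"
    and supp: "supports_queries (texts \<sigma> n) {1..n} suffix_array enc query"
  shows "real n * log 2 (real \<sigma>) \<le> 8 * real (worst_case_space (texts \<sigma> n) enc)"
proof -
  let ?L = "worst_case_space (texts \<sigma> n) enc" and ?k = "n div \<sigma>"
  obtain F M where F: "F \<subseteq> texts \<sigma> n" and M: "\<And>T. T \<in> F \<Longrightarrow> mset T = M"
    and card: "card F = fact \<sigma> ^ ?k"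
    using texts_with_common_mset[of \<sigma> n] assms(1) by auto
  \<comment> \<open>Equal encodings answer all queries alike, so the two texts share their suffix
    array as well as their multiset.\<close>
  have "inj_on enc F"
  proof (rule inj_onI)
    fix T U assume TU: "T \<in> F" "U \<in> F" "enc T = enc U"
    have "suffix_array T i = suffix_array U i" if "i \<in> {1..n}" for i
      using supp TU F that unfolding supports_queries_def by (metis subsetD)
    moreover have "length T = n" using TU(1) F by (auto simp: texts_def)
    ultimately show "T = U"
      using M[OF TU(1)] M[OF TU(2)] by (intro eq_if_mset_eq_and_suffix_array_eq) auto
  qed
  moreover have "length (enc T) \<le> ?L" if "T \<in> F" for T
    unfolding worst_case_space_def using that F finite_texts by (intro Max_ge) auto
  ultimately have lt: "fact \<sigma> ^ ?k < (2::nat) ^ Suc ?L"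
    unfolding card[symmetric] by (rule card_lt_two_power_if_inj_on_bool_lists)
  have k: "1 \<le> ?k" using assms by (simp add: div_greater_zero_iff Suc_le_eq)
  \<comment> \<open>With no space at all, \<open>lt\<close> would bound the family size by less than
    2. Hence \<open>?L\<close> is positive, which later absorbs the successor in
    \<open>Suc ?L\<close>.\<close>
  have "2 \<le> (fact \<sigma> :: nat)" using assms(1) fact_mono_nat[of 2 \<sigma>] by simp
  also have "\<dots> \<le> fact \<sigma> ^ ?k" using k by (intro self_le_power) auto
  finally have L: "1 \<le> ?L" using lt by (cases ?L) auto
  \<comment> \<open>The remainder is less than one block, and since \<open>?k\<close> is at least 1,
    doubling the number of blocks covers it.\<close>
  have "n < \<sigma> * ?k + \<sigma>" using assms(1) by (metis add_less_cancel_left mod_less_divisor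
        mult_div_mod_eq pos2 order_less_le_trans)
  also have "\<dots> \<le> \<sigma> * ?k + \<sigma> * ?k" using k by simp
  finally have "\<sigma> ^ n \<le> \<sigma> ^ (\<sigma> * (?k * 2))"
    using assms(1) by (intro power_increasing) auto
  also have "\<dots> = (\<sigma> ^ \<sigma>) ^ (?k * 2)" by (rule power_mult)
  also have "\<dots> \<le> ((fact \<sigma>)\<^sup>2) ^ (?k * 2)"
    by (intro power_mono power_self_le_fact_squared) auto
  also have "\<dots> = (fact \<sigma> ^ ?k) ^ 4"
    by (simp add: power_mult[symmetric] mult.commute)
  also have "\<dots> \<le> (2 ^ Suc ?L) ^ 4" using lt by (intro power_mono) auto
  also have "\<dots> = 2 ^ (4 * Suc ?L)" by (metis power_mult mult.commute)
  finally have "real (\<sigma> ^ n) \<le> real (2 ^ (4 * Suc ?L))" by (rule of_nat_mono)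
  then have "real \<sigma> ^ n \<le> 2 ^ (4 * Suc ?L)" by simp
  then have "log 2 (real \<sigma> ^ n) \<le> log 2 (2 ^ (4 * Suc ?L))"
    using assms(1) by (subst log_le_cancel_iff) auto
  then have "real n * log 2 (real \<sigma>) \<le> real (4 * Suc ?L)"
    using assms(1) by (simp only: log_nat_power log_pow_cancel) (simp add: log_nat_power)
  with L show ?thesis by simp
qed

theorem theorem5p4:
  shows "\<exists>\<delta>::real. \<delta> > 0 \<and>
    (\<forall>(\<sigma>::nat) (n::nat) (enc :: nat list \<Rightarrow> bool list) (query :: bool list \<Rightarrow> nat \<Rightarrow> nat).
       2 \<le> \<sigma> \<and> \<sigma> \<le> n \<and>
       supports_queries (texts \<sigma> n) {1..n} suffix_array enc query \<longrightarrow>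
       real (worst_case_space (texts \<sigma> n) enc) \<ge> \<delta> * real n * log 2 (real \<sigma>))"
proof (intro exI[of _ "1/8"] conjI allI impI)
  show "0 < (1/8 :: real)" by simp
next
  fix \<sigma> n and enc :: "nat list \<Rightarrow> bool list" and query :: "bool list \<Rightarrow> nat \<Rightarrow> nat"
  assume "2 \<le> \<sigma> \<and> \<sigma> \<le> n \<and> supports_queries (texts \<sigma> n) {1..n} suffix_array enc query"
  then show "1/8 * real n * log 2 (real \<sigma>) \<le> real (worst_case_space (texts \<sigma> n) enc)"
    using worst_case_space_suffix_array_ge[of \<sigma> n enc query] by simp
qed

end
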